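(* Let $K$ be an algebraically closed field and let $A,B\in\mathrm{M}(2,K)$ both be non-zero. Consider the polynomial map $\widetilde{w}\colon \mathrm{M}(2,K)^2\to\mathrm{M}(2,K)$ given by $(x,y)\mapsto Axy-Byx$. Then the image of $\widetilde{w}$ is a vector space, i.e. a $K$-linear subspace of $\mathrm{M}(2,K)$.
   Context: $\mathrm{M}(2,K)$ is the algebra of $2\times2$ matrices over $K$. *)

theory Defs
  imports "HOL-Analysis.Analysis" "HOL-Computational_Algebra.Polynomial"
begin

text \<open>
  The library's \<open>*s\<close> on \<open>'a ^ 'n ^ 'm\<close> would take its scalars from \<open>'a ^ 'n\<close>, and \<open>*\<^sub>R\<close> only
  covers real scalars; hence the scalar multiplication of matrices over an arbitrary field
  is introduced here, entrywise.
\<close>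

definition matrix_scale :: "'a::times \<Rightarrow> 'a ^ 'n ^ 'm \<Rightarrow> 'a ^ 'n ^ 'm" (infixr \<open>*\<^sub>M\<close> 75)
  where "c *\<^sub>M A = (\<chi> i j. c * A $ i $ j)"

lemma matrix_scale_component [simp]: "(c *\<^sub>M A) $ i $ j = c * A $ i $ j"
  by (simp add: matrix_scale_def)

global_interpretation matrix_space:
  vector_space "matrix_scale :: 'a::field \<Rightarrow> 'a ^ 'n ^ 'm \<Rightarrow> 'a ^ 'n ^ 'm"
  by unfold_locales (simp_all add: vec_eq_iff algebra_simps)

end

theory Submission
  imports Defs
begin

text \<open>
  Write \<open>w(x, y) = A x y - B y x\<close> and \<open>C = A - B\<close>. Fixing \<open>x = 1\<close> gives \<open>w(1, y) = C y\<close>, so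
  the image always contains \<open>C M(2, K)\<close>, and the rank of \<open>C\<close> decides what else happens.

  If \<open>C\<close> has rank two, \<open>w\<close> is onto. If \<open>C = 0\<close>, then \<open>w(x, y) = A [x, y]\<close>, and since the
  commutators of \<open>2 \<times> 2\<close> matrices are exactly the matrices of trace zero
  (\<open>trace_zero_is_commutator\<close>), the image is the image of a linear space under left
  multiplication by \<open>A\<close>.

  If \<open>C\<close> has rank one, the key is that replacing \<open>(A, B)\<close> by \<open>(P A Q, P B Q)\<close> with \<open>Q\<close>
  invertible merely transports the image by the linear map \<open>T \<mapsto> P T Q\<close>: conjugation by \<open>Q\<close>
  is absorbed by the variables (\<open>range_twisted_commutator_equivalent\<close>). Hence \<open>C\<close> may be taken
  to be the matrix unit \<open>E\<close> in the upper left corner. Then \<open>w(x, y) = A [x, y] + E y x\<close>, and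
  there are two possibilities. Either the second row of \<open>A\<close> vanishes; then every value of \<open>w\<close>
  has vanishing second row, and \<open>w(1, y) = E y\<close> already attains all such matrices. Or the
  second row \<open>(c, d)\<close> of \<open>A\<close> is non-zero; then \<open>w\<close> is onto, and even the linear map
  \<open>x \<mapsto> w(x, y)\<close> is bijective for a suitable fixed \<open>y\<close>, namely the matrix with rows \<open>(0, 1)\<close>
  and \<open>(s, 0)\<close> where \<open>s \<noteq> 0\<close> and \<open>c\<^sup>2 \<noteq> s d\<^sup>2\<close> (\<open>twisted_commutator_onto_if_corner_difference\<close>).
  Algebraic closedness provides such an \<open>s\<close>.
\<close>

section \<open>Two-by-two matrices and linear maps between them\<close>

definition mat2 :: "'a::zero \<Rightarrow> 'a \<Rightarrow> 'a \<Rightarrow> 'a \<Rightarrow> 'a ^ 2 ^ 2"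
  where "mat2 a b c d = vector [vector [a, b], vector [c, d]]"

lemma mat2_component [simp]:
  "mat2 a b c d $ 1 $ 1 = a" "mat2 a b c d $ 1 $ 2 = b"
  "mat2 a b c d $ 2 $ 1 = c" "mat2 a b c d $ 2 $ 2 = d"
  by (simp_all add: mat2_def)

lemma mat2_eq_iff:
  fixes X Y :: "'a ^ 2 ^ 2"
  shows "X = Y \<longleftrightarrow> X $ 1 $ 1 = Y $ 1 $ 1 \<and> X $ 1 $ 2 = Y $ 1 $ 2 \<and>
    X $ 2 $ 1 = Y $ 2 $ 1 \<and> X $ 2 $ 2 = Y $ 2 $ 2"
  by (auto simp: vec_eq_iff forall_2)

lemma matrix_mult_component_2:
  fixes X Y :: "'a::semiring_1 ^ 2 ^ 2"
  shows "(X ** Y) $ i $ j = X $ i $ 1 * Y $ 1 $ j + X $ i $ 2 * Y $ 2 $ j"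
  by (simp add: matrix_matrix_mult_def sum_2)

lemma mat_one_eq_mat2: "mat 1 = mat2 1 0 0 (1::'a::semiring_1)"
  by (simp add: mat2_eq_iff mat_def)

lemma subspace_two_sided_mult_image:
  fixes P Q :: "'a::field ^ 2 ^ 2"
  assumes "matrix_space.subspace S"
  shows "matrix_space.subspace ((\<lambda>T. P ** T ** Q) ` S)"
proof -
  have add: "P ** X ** Q + P ** Y ** Q = P ** (X + Y) ** Q" for X Y
    by (simp add: mat2_eq_iff matrix_mult_component_2 algebra_simps)
  have scale: "k *\<^sub>M (P ** X ** Q) = P ** (k *\<^sub>M X) ** Q" for k X
    by (simp add: mat2_eq_iff matrix_mult_component_2 algebra_simps)
  have "P ** 0 ** Q = 0"
    by (simp add: mat2_eq_iff matrix_mult_component_2)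
  then have "0 \<in> (\<lambda>T. P ** T ** Q) ` S"
    using matrix_space.subspace_0[OF assms] by (metis image_eqI)
  then show ?thesis
    using assms unfolding matrix_space.subspace_def by (auto simp: add scale)
qed

lemma nonzero_is_first_column_of_invertible:
  fixes p :: "'a::field ^ 2"
  assumes "p \<noteq> 0"
  obtains P :: "'a ^ 2 ^ 2" where "invertible P" "\<And>i. P $ i $ 1 = p $ i"
proof -
  have col: "mat2 (p $ 1) b (p $ 2) d $ i $ 1 = p $ i" for b d i
    using exhaust_2[of i] by auto
  have "p $ 1 \<noteq> 0 \<or> p $ 2 \<noteq> 0"
    using assms by (auto simp: vec_eq_iff forall_2)
  then have "invertible (mat2 (p $ 1) 1 (p $ 2) 0) \<or> invertible (mat2 (p $ 1) 0 (p $ 2) 1)"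
    by (auto simp: invertible_det_nz det_2)
  then show ?thesis
    using that col by metis
qed

text \<open>
  A singular non-zero \<open>C\<close> is an outer product \<open>p q\<^sup>T\<close>: around a non-zero entry \<open>C\<^sub>i\<^sub>j\<close> take for
  \<open>p\<close> its column and for \<open>q\<close> its row divided by that entry. Completing \<open>p\<close> and \<open>q\<close> to
  invertible matrices gives the rank normal form.
\<close>
lemma rank_one_normal_form:
  fixes C :: "'a::field ^ 2 ^ 2"
  assumes "C \<noteq> 0" "det C = 0"
  obtains P Q where "invertible P" "invertible Q" "C = P ** mat2 1 0 0 0 ** Q"
proof -
  obtain i j where nz: "C $ i $ j \<noteq> 0"
    using assms(1) by (auto simp: vec_eq_iff)
  have minor: "C $ k $ j * C $ i $ l = C $ k $ l * C $ i $ j" for k l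
    using assms(2) exhaust_2[of i] exhaust_2[of j] exhaust_2[of k] exhaust_2[of l]
    by (auto simp: det_2 algebra_simps)
  obtain P :: "'a ^ 2 ^ 2" where P: "invertible P" "\<And>k. P $ k $ 1 = C $ k $ j"
    using nonzero_is_first_column_of_invertible[of "\<chi> k. C $ k $ j"] nz
    by (auto simp: vec_eq_iff)
  obtain R :: "'a ^ 2 ^ 2" where R: "invertible R" "\<And>l. R $ l $ 1 = C $ i $ l / C $ i $ j"
    using nonzero_is_first_column_of_invertible[of "\<chi> l. C $ i $ l / C $ i $ j"] nz
    by (auto simp: vec_eq_iff)
  have "C = P ** mat2 1 0 0 0 ** transpose R"
    using nz by (simp add: mat2_eq_iff matrix_mult_component_2 transpose_def P R minor)
  moreover have "invertible (transpose R)"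
    using R(1) by (simp add: invertible_det_nz)
  ultimately show ?thesis
    using P(1) that by blast
qed

section \<open>The twisted commutator\<close>

definition twisted_commutator ::
    "'a::ring_1 ^ 2 ^ 2 \<Rightarrow> 'a ^ 2 ^ 2 \<Rightarrow> ('a ^ 2 ^ 2) \<times> ('a ^ 2 ^ 2) \<Rightarrow> 'a ^ 2 ^ 2"
  where "twisted_commutator A B = (\<lambda>(x, y). A ** x ** y - B ** y ** x)"

lemma twisted_commutator_one:
  fixes A B y :: "'a::ring_1 ^ 2 ^ 2"
  shows "twisted_commutator A B (mat 1, y) = (A - B) ** y"
  by (simp add: twisted_commutator_def mat2_eq_iff matrix_mult_component_2 mat_one_eq_mat2
    algebra_simps)

text \<open>
  Substituting \<open>Q x Q\<^sup>-\<^sup>1\<close> and \<open>Q y Q\<^sup>-\<^sup>1\<close> for the variables turns \<open>A x y Q\<close> into \<open>A Q x y\<close>, so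
  the right factor \<open>Q\<close> of the coefficients can be moved to the far right.
\<close>
lemma range_twisted_commutator_equivalent:
  fixes A B P Q :: "'a::field ^ 2 ^ 2"
  assumes "invertible Q"
  shows "range (twisted_commutator (P ** A ** Q) (P ** B ** Q)) =
    (\<lambda>T. P ** T ** Q) ` range (twisted_commutator A B)"
proof -
  obtain R where R: "Q ** R = mat 1" "R ** Q = mat 1"
    using assms by (auto simp: invertible_def)
  have cancel: "Q ** (R ** X) = X" "R ** (Q ** X) = X" for X :: "'a ^ 2 ^ 2"
    by (simp_all add: matrix_mul_assoc R)
  have diff: "X ** (Y - Z) = X ** Y - X ** Z" "(Y - Z) ** X = Y ** X - Z ** X"
    for X Y Z :: "'a ^ 2 ^ 2"
    by (simp_all add: mat2_eq_iff matrix_mult_component_2 algebra_simps)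
  have eq: "twisted_commutator (P ** A ** Q) (P ** B ** Q) (x, y) =
      P ** twisted_commutator A B (Q ** x ** R, Q ** y ** R) ** Q" for x y
    by (simp add: twisted_commutator_def diff matrix_mul_assoc[symmetric] cancel R)
  have eq': "P ** twisted_commutator A B (x, y) ** Q =
      twisted_commutator (P ** A ** Q) (P ** B ** Q) (R ** x ** Q, R ** y ** Q)" for x y
    by (simp add: twisted_commutator_def diff matrix_mul_assoc[symmetric] cancel R)
  show ?thesis
  proof (intro equalityI image_subsetI)
    show "twisted_commutator (P ** A ** Q) (P ** B ** Q) z \<in>
        (\<lambda>T. P ** T ** Q) ` range (twisted_commutator A B)" for z
      by (cases z) (simp only: eq, intro imageI UNIV_I)
    show "P ** T ** Q \<in> range (twisted_commutator (P ** A ** Q) (P ** B ** Q))"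
      if T: "T \<in> range (twisted_commutator A B)" for T
      using T
    proof (rule imageE)
      fix z assume "T = twisted_commutator A B z"
      then show ?thesis
        by (cases z) (simp only: eq', intro imageI UNIV_I)
    qed
  qed
qed

section \<open>Equal coefficients\<close>

text \<open>
  For non-scalar \<open>y\<close> the commutators \<open>[x, y]\<close> fill the space of all trace-zero \<open>T\<close> with
  \<open>trace (T y) = 0\<close>. The witnesses below come from choosing a \<open>y\<close> satisfying this
  linear condition for the given \<open>T\<close>.
\<close>
lemma trace_zero_is_commutator:
  fixes T :: "'a::field ^ 2 ^ 2"
  assumes "trace T = 0"
  obtains x y where "T = x ** y - y ** x"
proof -
  define p q r where "p = T $ 1 $ 1" and "q = T $ 1 $ 2" and "r = T $ 2 $ 1"
  have "T $ 2 $ 2 = - p"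
    using assms by (simp add: trace_def sum_2 p_def add_eq_0_iff)
  then have T: "T = mat2 p q r (- p)"
    by (simp add: mat2_eq_iff p_def q_def r_def)
  consider "q \<noteq> 0" | "r \<noteq> 0" | "q = 0" "r = 0" by blast
  then show ?thesis
  proof cases
    case 1
    then show ?thesis
      by (intro that[of "mat2 0 (- 1) (r / q) 0" "mat2 q 0 (- p) 0"])
        (simp add: T mat2_eq_iff matrix_mult_component_2)
  next
    case 2
    then show ?thesis
      by (intro that[of "mat2 0 (- q / r) 1 0" "mat2 r (- p) 0 0"])
        (simp add: T mat2_eq_iff matrix_mult_component_2)
  next
    case 3
    then show ?thesis
      by (intro that[of "mat2 0 p 0 0" "mat2 0 0 1 0"])
        (simp add: T mat2_eq_iff matrix_mult_component_2)
  qed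
qed

lemma subspace_range_twisted_commutator_same:
  fixes A :: "'a::field ^ 2 ^ 2"
  shows "matrix_space.subspace (range (twisted_commutator A A))"
proof -
  have eq: "twisted_commutator A A (x, y) = A ** (x ** y - y ** x) ** mat 1" for x y
    by (simp add: twisted_commutator_def mat2_eq_iff matrix_mult_component_2 algebra_simps)
  have "trace (x ** y - y ** x) = 0" for x y :: "'a ^ 2 ^ 2"
    by (simp add: trace_sub trace_mul_sym[of x y])
  moreover have "T \<in> range (\<lambda>(x, y). x ** y - y ** x)" if "trace T = 0" for T :: "'a ^ 2 ^ 2"
    using that by (rule trace_zero_is_commutator) auto
  ultimately have "range (\<lambda>(x, y). x ** y - y ** x) = {T :: 'a ^ 2 ^ 2. trace T = 0}"
    by auto
  moreover have "range (twisted_commutator A A) =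
      (\<lambda>T. A ** T ** mat 1) ` range (\<lambda>(x, y). x ** y - y ** x)"
    unfolding image_image by (rule image_cong) (auto simp: eq simp del: matrix_mul_rid)
  moreover have "matrix_space.subspace {T :: 'a ^ 2 ^ 2. trace T = 0}"
  proof -
    have "trace (k *\<^sub>M T) = k * trace T" for k and T :: "'a ^ 2 ^ 2"
      by (simp add: trace_def sum_2 distrib_left)
    moreover have "trace (0 :: 'a ^ 2 ^ 2) = 0"
      by (simp add: trace_def)
    ultimately show ?thesis
      by (simp add: matrix_space.subspace_def trace_add)
  qed
  ultimately show ?thesis
    by (simp only: subspace_two_sided_mult_image)
qed

section \<open>Coefficients differing by a corner matrix unit\<close>

text \<open>
  Let \<open>u, v\<close> be the rows of \<open>x\<close> and \<open>y\<close> the matrix with rows \<open>(0, 1)\<close> and \<open>(s, 0)\<close>, so that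
  \<open>y\<^sup>2 = s\<close>. With \<open>z = u y - v\<close>, the rows of \<open>[x, y]\<close> are \<open>z\<close> and \<open>- z y\<close>, and if \<open>(a, b)\<close>,
  \<open>(c, d)\<close> are the rows of \<open>A\<close>, then the rows of the value at \<open>(x, y)\<close> are
  \<open>z (a - b y) + v\<close> and \<open>z (c - d y)\<close>. As \<open>(c - d y) (c + d y) = c\<^sup>2 - s d\<^sup>2\<close>, this system is solved
  successively for \<open>z\<close>, \<open>v\<close> and \<open>u\<close>.
\<close>
lemma twisted_commutator_onto_if_corner_difference:
  fixes A B :: "'a::field ^ 2 ^ 2"
  assumes AB: "A - B = mat2 1 0 0 0"
    and s: "s \<noteq> 0" "(A $ 2 $ 1)\<^sup>2 \<noteq> s * (A $ 2 $ 2)\<^sup>2"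
  shows "range (twisted_commutator A B) = UNIV"
proof -
  define a b c d where "a = A $ 1 $ 1" and "b = A $ 1 $ 2" and "c = A $ 2 $ 1" and "d = A $ 2 $ 2"
  have A: "A = mat2 a b c d"
    by (simp add: mat2_eq_iff a_def b_def c_def d_def)
  have "B = A - mat2 1 0 0 0"
    using AB by (simp add: algebra_simps)
  then have B: "B = mat2 (a - 1) b c d"
    by (simp add: A mat2_eq_iff)
  define D where "D = c\<^sup>2 - s * d\<^sup>2"
  have D: "D \<noteq> 0"
    using s(2) by (simp add: D_def c_def d_def)
  have "T \<in> range (twisted_commutator A B)" for T
  proof -
    define z1 z2 where "z1 = (c * T $ 2 $ 1 + d * s * T $ 2 $ 2) / D"
      and "z2 = (c * T $ 2 $ 2 + d * T $ 2 $ 1) / D"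
    define v1 v2 where "v1 = T $ 1 $ 1 - a * z1 + b * s * z2"
      and "v2 = T $ 1 $ 2 - a * z2 + b * z1"
    have row2: "c * z1 - d * s * z2 = T $ 2 $ 1" "c * z2 - d * z1 = T $ 2 $ 2"
    proof -
      have "c * z1 - d * s * z2 = (D * T $ 2 $ 1) / D"
        by (simp add: z1_def z2_def D_def power2_eq_square algebra_simps flip: diff_divide_distrib)
      then show "c * z1 - d * s * z2 = T $ 2 $ 1" using D by simp
      have "c * z2 - d * z1 = (D * T $ 2 $ 2) / D"
        by (simp add: z1_def z2_def D_def power2_eq_square algebra_simps flip: diff_divide_distrib)
      then show "c * z2 - d * z1 = T $ 2 $ 2" using D by simp
    qed
    have row1: "T $ 1 $ 1 = v1 + a * z1 - b * s * z2" "T $ 1 $ 2 = v2 + a * z2 - b * z1"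
      by (simp_all add: v1_def v2_def)
    define w where "w = (z1 + v1) / s"
    have z1: "z1 = s * w - v1"
      using s(1) by (simp add: w_def)
    have "T = twisted_commutator A B (mat2 (z2 + v2) w v1 v2, mat2 0 1 s 0)"
      by (simp add: A B twisted_commutator_def mat2_eq_iff matrix_mult_component_2
        row1 row2[symmetric] z1 algebra_simps)
    then show ?thesis by blast
  qed
  then show ?thesis by blast
qed

lemma exists_nonzero_avoiding_square_ratio:
  fixes c d :: "'a::alg_closed_field"
  assumes "c \<noteq> 0 \<or> d \<noteq> 0"
  obtains s where "s \<noteq> 0" "c\<^sup>2 \<noteq> s * d\<^sup>2"
proof (cases "d = 0")
  case True
  with assms show ?thesis
    by (intro that[of 1]) auto
next
  case False
  define k where "k = c\<^sup>2 / d\<^sup>2"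
  \<comment> \<open>A root of \<open>X (X - k) = 1\<close> is neither \<open>0\<close> nor \<open>k\<close>.\<close>
  obtain s where "poly [:-1, -k, 1:] s = 0"
    using alg_closed_imp_poly_has_root[of "[:-1, -k, 1:]"] by auto
  then have "s * (s - k) = 1"
    by (simp add: algebra_simps)
  then have "s \<noteq> 0" "s \<noteq> k"
    by auto
  with False show ?thesis
    by (intro that[of s]) (auto simp: k_def)
qed

lemma subspace_range_twisted_commutator_corner:
  fixes A B :: "'a::alg_closed_field ^ 2 ^ 2"
  assumes AB: "A - B = mat2 1 0 0 0"
  shows "matrix_space.subspace (range (twisted_commutator A B))"
proof (cases "A $ 2 $ 1 = 0 \<and> A $ 2 $ 2 = 0")
  case False
  then obtain s where "s \<noteq> 0" "(A $ 2 $ 1)\<^sup>2 \<noteq> s * (A $ 2 $ 2)\<^sup>2"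
    using exists_nonzero_avoiding_square_ratio by blast
  then show ?thesis
    using twisted_commutator_onto_if_corner_difference[OF AB] by simp
next
  case True
  have "B = A - mat2 1 0 0 0"
    using AB by (simp add: algebra_simps)
  with True have "twisted_commutator A B (x, y) $ 2 = 0" for x y
    by (simp add: vec_eq_iff forall_2 twisted_commutator_def matrix_mult_component_2)
  moreover have "T = twisted_commutator A B (mat 1, T)" if "T $ 2 = 0" for T
    using that by (simp add: twisted_commutator_one AB mat2_eq_iff matrix_mult_component_2)
  ultimately have "range (twisted_commutator A B) = {T. T $ 2 = 0}"
    by auto
  then show ?thesis
    by (simp add: matrix_space.subspace_def vec_eq_iff)
qed

section \<open>The image is a linear subspace\<close>

theorem theorem2:
  fixes A B :: "'k::alg_closed_field ^ 2 ^ 2"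
  assumes "A \<noteq> 0" and "B \<noteq> 0"
  shows "matrix_space.subspace (range (\<lambda>(x, y). A ** x ** y - B ** y ** x))"
proof -
  consider "A = B" | "det (A - B) \<noteq> 0" | "A - B \<noteq> 0" "det (A - B) = 0"
    by auto
  then have "matrix_space.subspace (range (twisted_commutator A B))"
  proof cases
    case 1
    then show ?thesis
      by (simp add: subspace_range_twisted_commutator_same)
  next
    case 2
    then obtain R where "(A - B) ** R = mat 1"
      by (auto simp: invertible_det_nz[symmetric] invertible_def)
    then have "T = twisted_commutator A B (mat 1, R ** T)" for T
      by (simp add: twisted_commutator_one matrix_mul_assoc)
    then have "range (twisted_commutator A B) = UNIV"
      by blast
    then show ?thesis
      by simp
  next
    case 3
    then obtain P Q where PQ: "invertible P" "invertible Q"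
      and C: "A - B = P ** mat2 1 0 0 0 ** Q"
      by (rule rank_one_normal_form)
    obtain P' Q' where inv: "P ** P' = mat 1" "P' ** P = mat 1" "Q ** Q' = mat 1" "Q' ** Q = mat 1"
      using PQ by (auto simp: invertible_def)
    define A' B' where "A' = P' ** A ** Q'" and "B' = P' ** B ** Q'"
    have "P ** (P' ** X ** Q') ** Q = X" for X
      by (metis inv matrix_mul_assoc matrix_mul_lid matrix_mul_rid)
    then have AB: "A = P ** A' ** Q" "B = P ** B' ** Q"
      by (simp_all add: A'_def B'_def)
    have "A' - B' = P' ** (A - B) ** Q'"
      by (simp add: A'_def B'_def mat2_eq_iff matrix_mult_component_2 algebra_simps)
    also have "\<dots> = mat2 1 0 0 0"
      unfolding C by (metis inv matrix_mul_assoc matrix_mul_lid matrix_mul_rid)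
    finally have "matrix_space.subspace (range (twisted_commutator A' B'))"
      by (rule subspace_range_twisted_commutator_corner)
    then show ?thesis
      unfolding AB range_twisted_commutator_equivalent[OF PQ(2)]
      by (rule subspace_two_sided_mult_image)
  qed
  then show ?thesis
    by (simp add: twisted_commutator_def)
qed

end
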